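(* Let $t \ge 4$ be even and let $n \ge 4t + 16$ with $8 \mid n$. Let \[ S'_{t, n} = \{1, 2, \ldots, t-3 \} \cup \{ t-1, t \} \cup \left\{ \tfrac{n}{4}, \tfrac{n}{4} + 2 \right\} \cup \left\{ \tfrac{n}{2} - t, \tfrac{n}{2} - (t-1) \right\} \cup \left\{\tfrac{n}{2} - (t-3), \ldots, \tfrac{n}{2} - 2, \tfrac{n}{2} -1 \right\}. \] Then the circulant graph $\mathrm{Circ}(n, S'_{t, n})$ is a $4t$-regular circulant nut graph of order $n$.
   Context: For $n \ge 2$ and $S \subseteq \{1, 2, \ldots, \lfloor n/2 \rfloor\}$, $\mathrm{Circ}(n, S)$ denotes the simple graph on vertex set $\{0, 1, \ldots, n-1\}$ in which distinct vertices $i, j$ are adjacent if and only if $(j - i) \bmod n \in S$ or $(i - j) \bmod n \in S$ (so $S$ is its generator set). A nut graph is a graph with at least two vertices whose adjacency matrix has nullity exactly one and such that a nonzero vector spanning its null space has no zero entries; a circulant nut graph is a nut graph that is a circulant graph. *)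

theory Defs
  imports
    "Graph_Theory.Pair_Digraph"
    "Graph_Theory.Digraph_Isomorphism"
    "Jordan_Normal_Form.Matrix_Kernel"
begin

text \<open>
  A simple graph is a \<^locale>\<open>pair_graph\<close>: a finite, loop-free, symmetric digraph whose arcs
  are pairs of vertices, so that an edge \<open>uv\<close> appears as the two arcs \<open>(u, v)\<close> and \<open>(v, u)\<close>.
\<close>

text \<open>The differences are taken in \<^typ>\<open>int\<close>, so that \<open>mod\<close> yields a residue in \<open>{0..<n}\<close>.\<close>

definition Circ :: "nat \<Rightarrow> nat set \<Rightarrow> nat pair_pre_digraph" where
  "Circ n S = \<lparr>
     pverts = {0..<n},
     parcs = {(i, j). i \<in> {0..<n} \<and> j \<in> {0..<n} \<and> i \<noteq> j \<and>
                ((int j - int i) mod int n \<in> int ` S \<or> (int i - int j) mod int n \<in> int ` S)} \<rparr>"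

text \<open>The side conditions on \<open>n\<close> and \<open>S\<close> that \<^const>\<open>Circ\<close> itself leaves out are imposed here.\<close>

definition circulant_graph :: "'a pair_pre_digraph \<Rightarrow> bool" where
  "circulant_graph G \<longleftrightarrow>
     (\<exists>n S. n \<ge> 2 \<and> S \<subseteq> {1..n div 2} \<and> digraph_iso (with_proj (Circ n S)) (with_proj G))"

text \<open>In a \<^locale>\<open>pair_graph\<close> the out-degree of a vertex is its number of neighbours.\<close>

definition regular_graph :: "nat \<Rightarrow> 'a pair_pre_digraph \<Rightarrow> bool" where
  "regular_graph k G \<longleftrightarrow> pair_graph G \<and> (\<forall>v \<in> pverts G. out_degree (with_proj G) v = k)"

text \<open>
  Rows and columns follow the vertices in increasing order; for \<^term>\<open>Circ n S\<close> the index \<open>i\<close>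
  is the vertex \<open>i\<close>.
\<close>

definition adjacency_matrix :: "'a::linorder pair_pre_digraph \<Rightarrow> real mat" where
  "adjacency_matrix G =
     (let vs = sorted_list_of_set (pverts G)
      in mat (length vs) (length vs) (\<lambda>(i, j). if (vs ! i, vs ! j) \<in> parcs G then 1 else 0))"

definition nut_graph :: "'a::linorder pair_pre_digraph \<Rightarrow> bool" where
  "nut_graph G \<longleftrightarrow>
     pair_graph G \<and> card (pverts G) \<ge> 2 \<and>
     kernel_dim (adjacency_matrix G) = 1 \<and>
     (\<exists>v. v \<noteq> 0\<^sub>v (card (pverts G)) \<and>
          mat_kernel (adjacency_matrix G) = range (\<lambda>c. c \<cdot>\<^sub>v v) \<and>
          (\<forall>i < card (pverts G). v $ i \<noteq> 0))"

definition circulant_nut_graph :: "'a::linorder pair_pre_digraph \<Rightarrow> bool" where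
  "circulant_nut_graph G \<longleftrightarrow> nut_graph G \<and> circulant_graph G"

definition S' :: "nat \<Rightarrow> nat \<Rightarrow> nat set" where
  "S' t n = {1..t - 3} \<union> {t - 1, t} \<union> {n div 4, n div 4 + 2}
          \<union> {n div 2 - t, n div 2 - (t - 1)} \<union> {n div 2 - (t - 3)..n div 2 - 1}"

lemma S'_subset:
  assumes "t \<ge> 4" "n \<ge> 4 * t + 16"
  shows "S' t n \<subseteq> {1..n div 2}"
  using assms unfolding S'_def by auto

end

theory Submission
  imports Defs "Jordan_Normal_Form.Char_Poly" "HOL-Number_Theory.Cong"
begin

text \<open>
  The eigenvalues of the graph are \<open>\<lambda>(z) = \<Sum>s\<in>S. z\<^sup>s + z\<^sup>-\<^sup>s\<close> for the \<open>n\<close>-th roots of unity \<open>z\<close>,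
  and the claim amounts to \<open>\<lambda>(z) = 0 \<longleftrightarrow> z = -1\<close>. If the \<open>n/2\<close>-th power of \<open>z\<close> is \<open>-1\<close>, all
  generators but \<open>n/4\<close> and \<open>n/4 + 2\<close> cancel in pairs \<open>s\<close>, \<open>n/2 - s\<close>, and the rest is nonzero
  since \<open>8\<close> divides \<open>n\<close>. Otherwise \<open>\<lambda>(z) = 2 \<sigma> \<plusminus> (z + 1/z)\<^sup>2\<close> with \<open>\<sigma> \<in> \<int>[z]\<close>, so \<open>\<lambda>(z) = 0\<close> forces
  \<open>(z\<^sup>2 + 1)\<^sup>2 \<in> 2\<int>[z]\<close>, that is, \<open>z\<^sup>4\<close> is congruent to \<open>1\<close> modulo \<open>2\<int>[z]\<close>. Such a root of unity
  squares to \<open>1\<close> (its square is congruent to \<open>1\<close> modulo \<open>4\<close>, which only \<open>1\<close> is), so \<open>z\<^sup>8 = 1\<close>, and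
  for these \<open>z\<close> the sum is periodic in \<open>t\<close> and can be evaluated.
\<close>

section \<open>Roots of unity congruent to one\<close>

definition int_adjoin :: "'a::comm_ring_1 \<Rightarrow> 'a set" where
  "int_adjoin z = range (\<lambda>p. poly (map_poly of_int p) z)"

lemma int_adjoin_of_int: "of_int k \<in> int_adjoin z"
  unfolding int_adjoin_def by (rule range_eqI[of _ _ "[:k:]"]) (simp add: of_int_hom.map_poly_pCons_hom)

lemma int_adjoin_self: "z \<in> int_adjoin z"
  unfolding int_adjoin_def by (rule range_eqI[of _ _ "[:0, 1:]"]) (simp add: of_int_hom.map_poly_pCons_hom)

lemma int_adjoin_add:
  assumes "a \<in> int_adjoin z" "b \<in> int_adjoin z"
  shows "a + b \<in> int_adjoin z"
proof -
  obtain p q where "a = poly (map_poly of_int p) z" "b = poly (map_poly of_int q) z"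
    using assms unfolding int_adjoin_def by blast
  thus ?thesis unfolding int_adjoin_def
    by (intro range_eqI[of _ _ "p + q"]) (simp add: of_int_hom.map_poly_hom_add)
qed

lemma int_adjoin_mult:
  assumes "a \<in> int_adjoin z" "b \<in> int_adjoin z"
  shows "a * b \<in> int_adjoin z"
proof -
  obtain p q where "a = poly (map_poly of_int p) z" "b = poly (map_poly of_int q) z"
    using assms unfolding int_adjoin_def by blast
  thus ?thesis unfolding int_adjoin_def
    by (intro range_eqI[of _ _ "p * q"]) (simp add: of_int_poly_hom.hom_mult)
qed

lemma int_adjoin_minus: "a \<in> int_adjoin z \<Longrightarrow> - a \<in> int_adjoin z"
  using int_adjoin_mult[OF int_adjoin_of_int[of "-1"]] by fastforce

lemma int_adjoin_power: "a \<in> int_adjoin z \<Longrightarrow> a ^ k \<in> int_adjoin z"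
  by (induction k) (use int_adjoin_of_int[of 1] in \<open>auto intro: int_adjoin_mult\<close>)

lemma int_adjoin_sum: "(\<And>i. i \<in> I \<Longrightarrow> f i \<in> int_adjoin z) \<Longrightarrow> sum f I \<in> int_adjoin z"
  by (induction I rule: infinite_finite_induct)
    (use int_adjoin_of_int[of 0] in \<open>auto intro: int_adjoin_add\<close>)

lemmas int_adjoin_intros = int_adjoin_of_int int_adjoin_self int_adjoin_add int_adjoin_mult
  int_adjoin_minus int_adjoin_power int_adjoin_sum

lemma power_mod_root_of_unity:
  fixes z :: "'a::monoid_mult"
  assumes "z ^ N = 1"
  shows "z ^ (k mod N) = z ^ k"
proof -
  have "z ^ k = z ^ (N * (k div N) + k mod N)" by simp
  also have "\<dots> = z ^ (k mod N)" unfolding power_add power_mult assms by simp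
  finally show ?thesis by simp
qed

text \<open>Multiplication by an element of \<open>\<int>[z]\<close> acts on the vector \<open>(1, z, \<dots>, z\<^sup>N\<^sup>-\<^sup>1)\<close> through an
  integer matrix, so the element is a root of a monic integer characteristic polynomial.\<close>

lemma algebraic_int_int_adjoin:
  fixes z :: "'a::field_char_0"
  assumes z: "z ^ N = 1" and N: "N > 0" and b: "b \<in> int_adjoin z"
  shows "algebraic_int b"
proof -
  obtain p :: "int poly" where p: "b = poly (map_poly of_int p) z"
    using b unfolding int_adjoin_def by blast
  define c where "c k = (of_int (coeff p k) :: 'a)" for k
  have b_sum: "b = (\<Sum>k\<le>degree p. c k * z ^ k)"
    unfolding p poly_altdef c_def by (simp add: of_int_hom.degree_map_poly_hom)
  define A :: "int mat" where
    "A = mat N N (\<lambda>(i, j). \<Sum>k\<le>degree p. if (i + k) mod N = j then coeff p k else 0)"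
  let ?A = "map_mat of_int A :: 'a mat"
  have A: "A \<in> carrier_mat N N" and A': "?A \<in> carrier_mat N N" by (auto simp: A_def)
  define v where "v = vec N (\<lambda>i. z ^ i)"
  have "?A *\<^sub>v v = b \<cdot>\<^sub>v v"
  proof (rule eq_vecI)
    fix i assume "i < dim_vec (b \<cdot>\<^sub>v v)"
    hence i: "i < N" by (simp add: v_def)
    have "(?A *\<^sub>v v) $ i = (\<Sum>j<N. (\<Sum>k\<le>degree p. if (i + k) mod N = j then c k else 0) * z ^ j)"
      using i by (auto simp: A_def v_def scalar_prod_def c_def lessThan_atLeast0 intro!: sum.cong arg_cong2[of _ _ _ _ "(*)"])
    also have "\<dots> = (\<Sum>k\<le>degree p. \<Sum>j<N. (if j = (i + k) mod N then c k * z ^ j else 0))"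
      unfolding sum_distrib_right by (subst sum.swap) (auto intro!: sum.cong)
    also have "\<dots> = (\<Sum>k\<le>degree p. c k * z ^ (i + k))"
      using N by (simp add: power_mod_root_of_unity[OF z])
    also have "\<dots> = (b \<cdot>\<^sub>v v) $ i"
      using i by (simp add: b_sum v_def power_add sum_distrib_right mult.assoc mult.commute[of "z ^ i"])
    finally show "(?A *\<^sub>v v) $ i = (b \<cdot>\<^sub>v v) $ i" .
  qed (simp add: A_def v_def)
  moreover have "v $ 0 \<noteq> 0\<^sub>v N $ 0" using N by (simp add: v_def)
  hence "v \<noteq> 0\<^sub>v N" by metis
  ultimately have "eigenvalue ?A b"
    unfolding eigenvalue_def eigenvector_def using A by (intro exI[of _ v]) (auto simp: v_def)
  hence "poly (char_poly ?A) b = 0" using eigenvalue_root_char_poly[OF A'] by simp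
  moreover have "lead_coeff (char_poly ?A) = 1" using degree_monic_char_poly[OF A'] by simp
  ultimately show ?thesis
    by (intro algebraic_int.intros[of "char_poly ?A"]) (auto simp: of_int_hom.char_poly_hom[OF A])
qed

text \<open>The element \<open>b = m / 2\<close> is rational and an algebraic integer, hence an
  integer. So 2 divides no odd integer inside Z[z]; the parity contradictions below rest on
  this.\<close>

lemma even_if_two_dvd_int_adjoin:
  fixes z :: "'a::field_char_0"
  assumes "z ^ N = 1" "N > 0" and b: "b \<in> int_adjoin z" "of_int m = 2 * b"
  shows "even m"
proof -
  have "b = of_int m / 2" using b(2) by simp
  hence "b \<in> \<rat>" by (metis Rats_divide Rats_number_of Rats_of_int)
  moreover have "algebraic_int b" using algebraic_int_int_adjoin assms by blast
  ultimately obtain k where "b = of_int k"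
    using rational_algebraic_int_is_int by (auto elim: Ints_cases)
  hence "(of_int m :: 'a) = of_int (2 * k)" using b(2) by simp
  hence "m = 2 * k" by (simp only: of_int_eq_iff)
  thus ?thesis by simp
qed

section \<open>Roots of unity congruent to one modulo four and modulo two\<close>

lemma power_one_plus_four_mult:
  assumes "b \<in> int_adjoin z"
  obtains c where "c \<in> int_adjoin z" "(1 + 4 * b) ^ k = 1 + 4 * c"
proof (induction k arbitrary: thesis)
  case 0
  show ?case using 0[of 0] int_adjoin_of_int[of 0 z] by simp
next
  case (Suc k)
  obtain c where c: "c \<in> int_adjoin z" "(1 + 4 * b) ^ k = 1 + 4 * c" using Suc.IH by blast
  \<comment> \<open>This is the cofactor of 4 in the product of \<open>1 + 4 * b\<close> and
    \<open>1 + 4 * c\<close>.\<close>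
  have "b + c + 4 * (b * c) \<in> int_adjoin z"
    using assms c int_adjoin_of_int[of 4] by (auto intro!: int_adjoin_intros)
  moreover have "(1 + 4 * b) ^ Suc k = 1 + 4 * (b + c + 4 * (b * c))"
    by (simp only: power_Suc c(2)) (simp add: algebra_simps)
  ultimately show ?case using Suc.prems by blast
qed

text \<open>Descent on the exponent \<open>m\<close>. If \<open>m = 2 * k\<close>, the
  \<open>k\<close>-th power is 1 or -1, and -1 is not congruent to 1 modulo 4, so \<open>k\<close>
  serves in place of \<open>m\<close>. If \<open>m\<close> is odd, an element other than 1 would
  make the geometric sum of its first \<open>m\<close> powers vanish; but that sum is congruent to
  \<open>m\<close> modulo 4, which would make \<open>m\<close> even.\<close>

lemma root_of_unity_cong_one_mod_four:
  fixes z :: "'a::field_char_0"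
  assumes z: "z ^ N = 1" "N > 0" and b: "b \<in> int_adjoin z"
    and "(1 + 4 * b) ^ m = 1" "m > 0"
  shows "1 + 4 * b = 1"
  using assms(4,5)
proof (induction m rule: less_induct)
  case (less m)
  show ?case
  proof (cases "even m")
    case True
    then obtain k where k: "m = 2 * k" by blast
    obtain c where c: "c \<in> int_adjoin z" "(1 + 4 * b) ^ k = 1 + 4 * c"
      using power_one_plus_four_mult[OF b] .
    have "((1 + 4 * b) ^ k)\<^sup>2 = 1" using less.prems k by (simp add: power_mult mult.commute)
    moreover have "(1 + 4 * b) ^ k \<noteq> -1"
    proof
      assume "(1 + 4 * b) ^ k = -1"
      hence "4 * c = -2" using c(2) by (simp add: eq_neg_iff_add_eq_0 algebra_simps)
      hence "of_int 1 = 2 * (- c)" by simp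
      thus False using even_if_two_dvd_int_adjoin[OF z int_adjoin_minus[OF c(1)]] by fastforce
    qed
    ultimately show ?thesis using less.IH[of k] less.prems k by (auto simp: power2_eq_1_iff)
  next
    case False
    show ?thesis
    proof (rule ccontr)
      assume ne: "1 + 4 * b \<noteq> 1"
      have "\<exists>c \<in> int_adjoin z. (1 + 4 * b) ^ i = 1 + 4 * c" for i
        using power_one_plus_four_mult[OF b] by blast
      then obtain c where c: "\<And>i. c i \<in> int_adjoin z" "\<And>i. (1 + 4 * b) ^ i = 1 + 4 * c i"
        by metis
      have "4 * b * (\<Sum>i<m. (1 + 4 * b) ^ i) = 0"
        using power_diff_1_eq[of "1 + 4 * b" m] less.prems by simp
      hence "(\<Sum>i<m. (1 + 4 * b) ^ i) = 0" using ne by simp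
      hence "of_nat m + 4 * (\<Sum>i<m. c i) = 0"
        by (simp add: c(2) sum.distrib sum_distrib_left)
      hence "of_int (int m) = 2 * (of_int (-2) * (\<Sum>i<m. c i))"
        by (simp add: eq_neg_iff_add_eq_0)
      hence "even (int m)"
        by (rule even_if_two_dvd_int_adjoin[OF z, rotated]) (intro int_adjoin_intros c)
      thus False using False by simp
    qed
  qed
qed

text \<open>Squaring lifts the congruence from modulus 2 to modulus 4, and the square is again a
  root of unity.\<close>

lemma root_of_unity_cong_one_mod_two:
  fixes z :: "'a::field_char_0"
  assumes z: "z ^ N = 1" "N > 0" and b: "b \<in> int_adjoin z"
    and m: "(1 + 2 * b) ^ m = 1" "m > 0"
  shows "(1 + 2 * b)\<^sup>2 = 1"
proof -
  have sq: "(1 + 2 * b)\<^sup>2 = 1 + 4 * (b + b\<^sup>2)" by (simp add: power2_eq_square algebra_simps)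
  have "(1 + 4 * (b + b\<^sup>2)) ^ m = ((1 + 2 * b) ^ m)\<^sup>2"
    unfolding sq[symmetric] by (simp add: power_mult[symmetric] mult.commute)
  thus ?thesis unfolding sq using m
    by (intro root_of_unity_cong_one_mod_four[OF z]) (auto intro!: int_adjoin_intros b)
qed

text \<open>The cross term of the expanded square is even, so the hypothesis makes
  \<open>z ^ 4\<close> congruent to 1 modulo 2, and \<open>z ^ 4\<close> is again a root of
  unity.\<close>

lemma power_eight_eq_one_if_two_dvd:
  fixes z :: "'a::field_char_0"
  assumes z: "z ^ N = 1" "N > 0" and b: "b \<in> int_adjoin z" "(z\<^sup>2 + 1)\<^sup>2 = 2 * b"
  shows "z ^ 8 = 1"
proof -
  have eq: "z ^ 4 = 1 + 2 * (b - z\<^sup>2 - 1)"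
    using b(2) by (simp add: power2_eq_square power4_eq_xxxx algebra_simps)
  have "b + - (z\<^sup>2) + of_int (-1) \<in> int_adjoin z" by (intro int_adjoin_intros b)
  hence "b - z\<^sup>2 - 1 \<in> int_adjoin z" by simp
  moreover have "(z ^ 4) ^ N = 1"
    using z(1) by (metis mult.commute power_mult power_one)
  ultimately have "(z ^ 4)\<^sup>2 = 1"
    using root_of_unity_cong_one_mod_two[OF z, of "b - z\<^sup>2 - 1" N] z(2) unfolding eq by simp
  thus ?thesis by simp
qed

section \<open>Eigenvalues of the circulant graph\<close>

text \<open>The contribution of a generator \<open>k\<close> to the eigenvalue at \<open>z\<close>;
  for complex \<open>z\<close> on the unit circle it is twice the cosine of \<open>k\<close> times
  the argument. The field is left general because the value at -1 is also needed over the
  reals.\<close>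

definition power_trace :: "'a::field \<Rightarrow> nat \<Rightarrow> 'a" where
  "power_trace z k = z ^ k + inverse z ^ k"

section \<open>Generator sums at eighth roots of unity\<close>

lemma sum_power_trace_if_square_eq_minus_one:
  fixes z :: "'a::field_char_0"
  assumes z: "z\<^sup>2 = -1" and t: "even t" "t \<ge> 4"
  shows "(\<Sum>s=1..t. power_trace z s) - power_trace z (t - 2) \<in> {2, -4}"
  using t
proof (induction t rule: less_induct)
  case (less t)
  let ?h = "power_trace z"
  have inv: "inverse z = - z"
    using z by (intro inverse_unique) (simp add: power2_eq_square)
  \<comment> \<open>By this sign change four consecutive terms cancel, so the expression has period
    4 in \<open>t\<close>. The cases \<open>t = 4\<close> and \<open>t = 6\<close> give 2 and
    -4.\<close>
  have per: "?h (k + 2) = - ?h k" for k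
    unfolding power_trace_def power_add z inv power2_minus by simp
  have h: "?h 0 = 2" "?h 1 = 0" by (simp_all add: power_trace_def inv)
  have h2: "?h 2 = -2" "?h 3 = 0" by (simp_all add: power_trace_def inv z)
  have h': "?h 4 = 2" "?h 5 = 0" "?h 6 = -2"
    using per[of 2] per[of 3] per[of 4] h2 by simp_all
  have "t = 4 \<or> t = 6 \<or> t \<ge> 8" using less.prems by presburger
  then consider "t = 4" | "t = 6" | "t \<ge> 8" by blast
  thus ?case
  proof cases
    case 1
    have "(\<Sum>s=1..4. ?h s) = ?h 1 + ?h 2 + ?h 3 + ?h 4" by (simp add: eval_nat_numeral)
    thus ?thesis using 1 h h2 h' by simp
  next
    case 2
    have "(\<Sum>s=1..6. ?h s) = ?h 1 + ?h 2 + ?h 3 + ?h 4 + ?h 5 + ?h 6"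
      by (simp add: eval_nat_numeral)
    thus ?thesis using 2 h h2 h' by simp
  next
    case 3
    then obtain u where u: "t = u + 4" "u \<ge> 4"
      by (intro that[of "t - 4"]) auto
    have "(\<Sum>s=1..t. ?h s)
        = (\<Sum>s=1..u. ?h s) + ?h (u + 1) + ?h (u + 2) + ?h (u + 1 + 2) + ?h (u + 2 + 2)"
      unfolding u by (simp add: eval_nat_numeral)
    also have "\<dots> = (\<Sum>s=1..u. ?h s)" unfolding per by simp
    finally have "(\<Sum>s=1..t. ?h s) = (\<Sum>s=1..u. ?h s)" .
    moreover have "?h (t - 2) = ?h (u - 2)"
    proof -
      have "t - 2 = u - 2 + 2 + 2" using u by simp
      thus ?thesis by (simp only: per minus_minus)
    qed
    ultimately show ?thesis using less.IH[of u] less.prems u by simp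
  qed
qed

text \<open>Here \<open>z\<close> is a primitive eighth root of unity, so its inverse is
  \<open>- (z ^ 3)\<close> and \<open>power_trace z 1\<close> is a square root of 2.\<close>

lemma power_trace_if_power_four_eq_minus_one:
  fixes z :: "'a::field_char_0"
  assumes z: "z ^ 4 = -1"
  shows "power_trace z (k + 4) = - power_trace z k" "power_trace z 2 = 0"
    "power_trace z 3 = - power_trace z 1" "(power_trace z 1)\<^sup>2 = 2"
proof -
  have inv: "inverse z = - (z ^ 3)"
    using z by (intro inverse_unique) (simp add: power3_eq_cube power4_eq_xxxx mult.assoc)
  have inv4: "inverse z ^ 4 = -1" by (simp add: power_inverse z)
  show "power_trace z (k + 4) = - power_trace z k"
    using z inv4 by (simp add: power_trace_def power_add)
  have "z ^ 6 = - (z\<^sup>2)" using z by (simp add: eval_nat_numeral)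
  thus "power_trace z 2 = 0"
    by (simp add: power_trace_def inv power_mult[symmetric])
  have "z ^ 9 = z" using z by (simp add: eval_nat_numeral)
  thus "power_trace z 3 = - power_trace z 1"
    by (simp add: power_trace_def inv power_mult[symmetric])
  have "(power_trace z 1)\<^sup>2 = z\<^sup>2 + z ^ 6 - 2 * z ^ 4"
    by (simp add: power_trace_def inv power2_diff power_mult[symmetric] eval_nat_numeral algebra_simps)
  thus "(power_trace z 1)\<^sup>2 = 2" using \<open>z ^ 6 = - (z\<^sup>2)\<close> z by simp
qed

text \<open>A shift by 4 changes the sign of the traces, so the expression has period 8 in
  \<open>t\<close>. The even residues are covered by \<open>t\<close> = 4, 6, 8, 10, with the values
  -2, \<open>- y\<close>, 0 and \<open>y - 2\<close>.\<close>

lemma sum_power_trace_if_power_four_eq_minus_one: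
  fixes z :: "'a::field_char_0"
  assumes z: "z ^ 4 = -1" and t: "even t" "t \<ge> 4"
  defines "y \<equiv> power_trace z 1"
  shows "(\<Sum>s=1..t. power_trace z s) - power_trace z (t - 2) \<in> {0, y - 2, -2, - y}"
  using t
proof (induction t rule: less_induct)
  case (less t)
  let ?h = "power_trace z"
  note per = power_trace_if_power_four_eq_minus_one(1)[OF z]
  have h: "?h 0 = 2" "?h 1 = y" "?h 2 = 0" "?h 3 = - y"
    using power_trace_if_power_four_eq_minus_one[OF z] by (simp_all add: power_trace_def y_def)
  have h': "?h 4 = -2" "?h 5 = -y" "?h 6 = 0" "?h 7 = y"
    using per[of 0] per[of 1] per[of 2] per[of 3] h by simp_all
  have h'': "?h 8 = 2" "?h 9 = y" "?h 10 = 0"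
    using per[of 4] per[of 5] per[of 6] h' by simp_all
  note h_all = h h' h''
  have "t = 4 \<or> t = 6 \<or> t = 8 \<or> t = 10 \<or> t \<ge> 12" using less.prems by presburger
  then consider "t = 4" | "t = 6" | "t = 8" | "t = 10" | "t \<ge> 12" by blast
  thus ?case
  proof cases
    case 1
    have "(\<Sum>s=1..4. ?h s) = ?h 1 + ?h 2 + ?h 3 + ?h 4" by (simp add: eval_nat_numeral)
    thus ?thesis using 1 h_all by simp
  next
    case 2
    have "(\<Sum>s=1..6. ?h s) = ?h 1 + ?h 2 + ?h 3 + ?h 4 + ?h 5 + ?h 6"
      by (simp add: eval_nat_numeral)
    thus ?thesis using 2 h_all by simp
  next
    case 3
    have "(\<Sum>s=1..8. ?h s) = ?h 1 + ?h 2 + ?h 3 + ?h 4 + ?h 5 + ?h 6 + ?h 7 + ?h 8"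
      by (simp add: eval_nat_numeral)
    thus ?thesis using 3 h_all by simp
  next
    case 4
    have "(\<Sum>s=1..10. ?h s)
        = ?h 1 + ?h 2 + ?h 3 + ?h 4 + ?h 5 + ?h 6 + ?h 7 + ?h 8 + ?h 9 + ?h 10"
      by (simp add: eval_nat_numeral)
    thus ?thesis using 4 h_all by simp
  next
    case 5
    then obtain u where u: "t = u + 8" "u \<ge> 4"
      by (intro that[of "t - 8"]) auto
    have "(\<Sum>s=1..t. ?h s) = (\<Sum>s=1..u. ?h s) + ?h (u + 1) + ?h (u + 2) + ?h (u + 3) + ?h (u + 4)
        + ?h (u + 1 + 4) + ?h (u + 2 + 4) + ?h (u + 3 + 4) + ?h (u + 4 + 4)"
      unfolding u by (simp add: eval_nat_numeral)
    also have "\<dots> = (\<Sum>s=1..u. ?h s)" unfolding per by simp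
    finally have "(\<Sum>s=1..t. ?h s) = (\<Sum>s=1..u. ?h s)" .
    moreover have "?h (t - 2) = ?h (u - 2)"
    proof -
      have "t - 2 = u - 2 + 4 + 4" using u by simp
      thus ?thesis by (simp only: per minus_minus)
    qed
    ultimately show ?thesis using less.IH[of u] less.prems u by simp
  qed
qed

text \<open>Factoring \<open>z ^ 8 - 1\<close> leaves three cases. At \<open>z = 1\<close> the value
  is \<open>4 * t\<close> or \<open>4 * (t - 2)\<close>; at a primitive fourth root of unity the
  square vanishes and 4 or -8 remains; at a primitive eighth root of unity the irrationality of the
  square root of 2 decides.\<close>

lemma eighth_root_of_unity_sum_nonzero:
  fixes z :: "'a::field_char_0"
  assumes z: "z ^ 8 = 1" "z \<noteq> -1" and t: "even t" "t \<ge> 4" and a: "a = 1 \<or> a = -1"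
  shows "2 * ((\<Sum>s=1..t. power_trace z s) - power_trace z (t - 2)) + a * (power_trace z 1)\<^sup>2 \<noteq> 0"
proof -
  define T where "T = (\<Sum>s=1..t. power_trace z s) - power_trace z (t - 2)"
  have "(z - 1) * (z + 1) * (z\<^sup>2 + 1) * (z ^ 4 + 1) = 0"
    using z(1) by (simp add: algebra_simps eval_nat_numeral)
  hence "z = 1 \<or> z\<^sup>2 = -1 \<or> z ^ 4 = -1"
    using z(2) by (auto simp: eq_neg_iff_add_eq_0)
  moreover have ?thesis if "z = 1"
  proof -
    have "T = of_nat (2 * (t - 1))"
      using t unfolding T_def that by (simp add: power_trace_def of_nat_diff)
    hence eq: "2 * T + a * (power_trace z 1)\<^sup>2 = of_nat (4 * (t - 1)) + 4 * a"
      by (simp add: power_trace_def that)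
    show ?thesis using a
    proof
      assume "a = 1"
      hence "2 * T + a * (power_trace z 1)\<^sup>2 = of_nat (4 * t)"
        using t unfolding eq by (simp add: of_nat_diff)
      thus ?thesis using t unfolding T_def by (simp del: of_nat_mult)
    next
      assume "a = -1"
      hence "2 * T + a * (power_trace z 1)\<^sup>2 = of_nat (4 * (t - 2))"
        using t unfolding eq by (simp add: of_nat_diff)
      thus ?thesis using t unfolding T_def by (simp del: of_nat_mult)
    qed
  qed
  moreover have ?thesis if "z\<^sup>2 = -1"
  proof -
    have "inverse z = - z"
      using that by (intro inverse_unique) (simp add: power2_eq_square)
    hence "power_trace z 1 = 0" by (simp add: power_trace_def)
    moreover have "T \<in> {2, -4}"
      unfolding T_def by (rule sum_power_trace_if_square_eq_minus_one[OF that t])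
    ultimately show ?thesis unfolding T_def by auto
  qed
  moreover have ?thesis if "z ^ 4 = -1"
  proof
    define y where "y = power_trace z 1"
    have y: "y\<^sup>2 = 2"
      unfolding y_def by (rule power_trace_if_power_four_eq_minus_one(4)[OF that])
    assume "2 * ((\<Sum>s=1..t. power_trace z s) - power_trace z (t - 2)) + a * (power_trace z 1)\<^sup>2 = 0"
    hence "2 * (T + a) = 0" using y by (simp add: T_def y_def algebra_simps)
    hence "T + a = 0" by (simp only: mult_eq_0_iff) simp
    hence "T = - a" by (simp add: eq_neg_iff_add_eq_0)
    moreover have "T \<in> {0, y - 2, -2, - y}"
      unfolding T_def y_def by (rule sum_power_trace_if_power_four_eq_minus_one[OF that t])
    \<comment> \<open>The values 0 and -2 of \<open>T\<close> are not \<open>- a\<close>; the other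
      two give \<open>y = 2 - a\<close> or \<open>y = a\<close>, none of which squares to 2.\<close>
    ultimately have "y \<in> {1, -1, 3}" using a
      by (auto simp: algebra_simps minus_equation_iff[of y])
    thus False using y by auto
  qed
  ultimately show ?thesis by blast
qed

section \<open>Reflection structure of the generator set and its eigenvalues\<close>

definition initial_gens :: "nat \<Rightarrow> nat set" where
  "initial_gens t = {1..t - 3} \<union> {t - 1, t}"

text \<open>With \<open>n = 8 * m\<close>, the quarter and the half of \<open>n\<close> are
  \<open>2 * m\<close> and \<open>4 * m\<close>, and the bound \<open>n \<ge> 4 * t + 16\<close>
  reads \<open>t + 4 \<le> 2 * m\<close>. The upper block of generators is the mirror image of the
  lower one under \<open>s\<close> to \<open>4 * m - s\<close>.\<close>

lemma S'_eq_reflected: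
  assumes "t \<ge> 4" "n = 8 * m" "t + 4 \<le> 2 * m"
  shows "S' t n = initial_gens t \<union> (\<lambda>s. 4 * m - s) ` initial_gens t \<union> {2 * m, 2 * m + 2}"
proof -
  have "{4 * m - (t - 3)..4 * m - 1} = (\<lambda>s. 4 * m - s) ` {1..t - 3}" (is "?L = ?R")
  proof
    show "?L \<subseteq> ?R"
    proof
      fix x assume "x \<in> ?L"
      thus "x \<in> ?R" using assms by (intro image_eqI[of _ _ "4 * m - x"]) auto
    qed
    show "?R \<subseteq> ?L" using assms by auto
  qed
  thus ?thesis using assms by (auto simp: S'_def initial_gens_def)
qed

text \<open>The three blocks are disjoint: the lower one ends at \<open>t < 2 * m\<close>, and the
  reflected one starts at \<open>4 * m - t\<close>, which is at least
  \<open>2 * m + 4\<close>.\<close>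

lemma sum_S':
  fixes f :: "nat \<Rightarrow> 'a::ab_group_add"
  assumes "t \<ge> 4" "n = 8 * m" "t + 4 \<le> 2 * m"
  shows "sum f (S' t n) = sum f (initial_gens t) + (\<Sum>s\<in>initial_gens t. f (4 * m - s))
           + f (2 * m) + f (2 * m + 2)"
proof -
  let ?A = "initial_gens t"
  let ?B = "(\<lambda>s. 4 * m - s) ` ?A"
  have fin: "finite ?A" by (simp add: initial_gens_def)
  have le: "s \<le> t" if "s \<in> ?A" for s using that assms by (auto simp: initial_gens_def)
  have "?A \<inter> ?B = {}" using assms by (auto dest!: le)
  moreover have "(?A \<union> ?B) \<inter> {2 * m, 2 * m + 2} = {}" using assms by (auto dest!: le)
  ultimately have "sum f (S' t n) = sum f ?A + sum f ?B + sum f {2 * m, 2 * m + 2}"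
    unfolding S'_eq_reflected[OF assms] using fin by (simp add: sum.union_disjoint)
  moreover have "inj_on (\<lambda>s. 4 * m - s) ?A"
    using assms by (intro inj_onI) (auto dest!: le)
  hence "sum f ?B = (\<Sum>s\<in>?A. f (4 * m - s))" by (simp add: sum.reindex)
  ultimately show ?thesis by (simp add: add.assoc)
qed

lemma sum_initial_gens:
  fixes f :: "nat \<Rightarrow> 'a::ab_group_add"
  assumes "t \<ge> 4"
  shows "sum f (initial_gens t) = (\<Sum>s=1..t. f s) - f (t - 2)"
proof -
  have "initial_gens t = {1..t} - {t - 2}" using assms by (auto simp: initial_gens_def)
  moreover have "t - 2 \<in> {1..t}" using assms by simp
  ultimately show ?thesis by (simp add: sum_diff1)
qed

lemma sum_power_trace_minus_one:
  assumes "even t"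
  shows "(\<Sum>s=1..t. power_trace (-1 :: 'a::field_char_0) s) = 0"
proof -
  obtain k where "t = 2 * k" using assms by blast
  moreover have "(\<Sum>s=1..2 * k. power_trace (-1 :: 'a) s) = 0"
    by (induction k) (simp_all add: power_trace_def)
  ultimately show ?thesis by simp
qed

lemma sum_power_trace_S'_eq_0_iff:
  fixes z :: "'a::field_char_0"
  assumes t: "even t" "t \<ge> 4" and n: "n = 8 * m" "t + 4 \<le> 2 * m" and z: "z ^ n = 1"
  shows "(\<Sum>s\<in>S' t n. power_trace z s) = 0 \<longleftrightarrow> z = -1"
proof -
  let ?h = "power_trace z"
  let ?\<Sigma> = "sum ?h (initial_gens t)"
  \<comment> \<open>This is the power of \<open>z\<close> to the quarter of \<open>n\<close>, a
    fourth root of unity; its square, the power to the half of \<open>n\<close>, is 1 or -1.\<close>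
  define a where "a = z ^ (2 * m)"
  have m: "m > 0" using n by simp
  have z0: "z \<noteq> 0" using z n m by (auto simp: power_0_left)
  have le: "s \<le> 4 * m" if "s \<in> initial_gens t" for s
    using that t n by (auto simp: initial_gens_def)
  have a_sq: "z ^ (4 * m) = a\<^sup>2" by (simp add: a_def power_mult[symmetric] mult.commute)
  have "(a\<^sup>2)\<^sup>2 = 1" using z unfolding a_sq[symmetric] n by (simp add: power_mult[symmetric] mult.commute)
  hence a_cases: "a\<^sup>2 = 1 \<or> a\<^sup>2 = -1" by (simp only: power2_eq_1_iff)
  have inv_sq: "inverse (a\<^sup>2) = a\<^sup>2" using a_cases by auto
  have refl: "?h (4 * m - s) = a\<^sup>2 * ?h s" if "s \<in> initial_gens t" for s
  proof -
    have "z ^ (4 * m - s) = a\<^sup>2 * inverse z ^ s"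
      using power_diff[OF z0 le[OF that]] by (simp add: a_sq power_inverse divide_inverse)
    moreover from this have "inverse z ^ (4 * m - s) = a\<^sup>2 * z ^ s"
      by (simp add: power_inverse inv_sq)
    ultimately show ?thesis by (simp add: power_trace_def algebra_simps)
  qed
  have split: "sum ?h (S' t n) = (1 + a\<^sup>2) * ?\<Sigma> + ?h (2 * m) + ?h (2 * m + 2)"
  proof -
    have "(\<Sum>s\<in>initial_gens t. ?h (4 * m - s)) = a\<^sup>2 * ?\<Sigma>"
      unfolding sum_distrib_left by (rule sum.cong[OF HOL.refl refl])
    thus ?thesis unfolding sum_S'[OF t(2) n] distrib_right by simp
  qed
  from a_cases show ?thesis
  proof
    assume a: "a\<^sup>2 = -1"
    have "inverse a = - a"
      using a by (intro inverse_unique) (simp add: power2_eq_square)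
    \<comment> \<open>The two blocks cancel, and only the generators \<open>2 * m\<close> and
      \<open>2 * m + 2\<close> remain. The difference vanishes only if \<open>z ^ 4 = 1\<close>,
      which would force \<open>z ^ (4 * m) = 1\<close>.\<close>
    hence "sum ?h (S' t n) = a * (z\<^sup>2 - inverse z ^ 2)"
      unfolding split a power_trace_def power_add power_inverse a_def[symmetric]
      by (simp add: algebra_simps)
    moreover have "a \<noteq> 0" using a by auto
    moreover have "z\<^sup>2 \<noteq> inverse z ^ 2"
    proof
      assume "z\<^sup>2 = inverse z ^ 2"
      hence "z ^ 4 = 1" using z0 by (simp add: field_simps eval_nat_numeral)
      hence "z ^ (4 * m) = 1" by (simp add: power_mult)
      thus False using a a_sq by simp
    qed
    moreover have "z \<noteq> -1" using a a_sq by (auto simp: power_mult)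
    ultimately show ?thesis by simp
  next
    assume a: "a\<^sup>2 = 1"
    have inv_a: "inverse a = a"
      using a by (intro inverse_unique) (simp add: power2_eq_square)
    \<comment> \<open>The two middle generators contribute \<open>a\<close> times
      \<open>2 + z ^ 2 + inverse z ^ 2\<close>, a perfect square.\<close>
    have eq: "sum ?h (S' t n) = 2 * ?\<Sigma> + a * (?h 1)\<^sup>2"
      using inv_a z0 unfolding split a power_trace_def power_add power_inverse a_def[symmetric]
      by (simp add: algebra_simps power2_eq_square)
    show ?thesis
    proof
      assume "z = -1"
      hence "?\<Sigma> = -2" using t
        unfolding sum_initial_gens[OF t(2)] \<open>z = -1\<close> sum_power_trace_minus_one[OF t(1)]
        by (simp add: power_trace_def)
      moreover have "a = 1" "?h 1 = -2" using \<open>z = -1\<close> by (simp_all add: a_def power_trace_def)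
      ultimately show "sum ?h (S' t n) = 0" unfolding eq by simp
    next
      assume 0: "sum ?h (S' t n) = 0"
      \<comment> \<open>Elements of \<open>int_adjoin z\<close> are polynomials in \<open>z\<close>
        alone, so the inverse has to be written as a positive power.\<close>
      have "inverse z = z ^ (n - 1)"
        using z n m by (intro inverse_unique) (simp add: power_Suc[symmetric] del: power_Suc)
      hence h_int: "?h s \<in> int_adjoin z" for s
        unfolding power_trace_def by (auto intro!: int_adjoin_intros)
      \<comment> \<open>Multiplying by \<open>z ^ 2\<close> clears the denominators; the factor
        \<open>a * a = 1\<close> is inserted so that the vanishing eigenvalue can be
        substituted.\<close>
      have "(z\<^sup>2 + 1)\<^sup>2 = z\<^sup>2 * (?h 1)\<^sup>2"
        using z0 by (simp add: power_trace_def power2_eq_square field_simps)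
      also have "\<dots> = a * z\<^sup>2 * (a * (?h 1)\<^sup>2)" using a by (simp add: power2_eq_square)
      also have "a * (?h 1)\<^sup>2 = - (2 * ?\<Sigma>)" using 0 eq by (simp add: eq_neg_iff_add_eq_0 add.commute)
      finally have "(z\<^sup>2 + 1)\<^sup>2 = 2 * (- (a * z\<^sup>2 * ?\<Sigma>))"
        by (simp only: mult_minus_right mult.left_commute[of "a * z\<^sup>2" 2])
      moreover have "- (a * z\<^sup>2 * ?\<Sigma>) \<in> int_adjoin z"
        unfolding a_def by (intro int_adjoin_intros h_int)
      moreover have "n > 0" using n m by simp
      ultimately have "z ^ 8 = 1"
        by (intro power_eight_eq_one_if_two_dvd[OF z])
      moreover have "a = 1 \<or> a = -1" using a by (simp add: power2_eq_1_iff)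
      ultimately have "2 * ?\<Sigma> + a * (?h 1)\<^sup>2 \<noteq> 0" if "z \<noteq> -1"
        unfolding sum_initial_gens[OF t(2)]
        using that by (intro eighth_root_of_unity_sum_nonzero t)
      thus "z = -1" using 0 unfolding eq by blast
    qed
  qed
qed

section \<open>Circulant graphs and their null spaces\<close>

text \<open>The generators together with their negatives modulo \<open>n\<close>, where
  \<open>n - s\<close> represents the negative of \<open>s\<close>.\<close>

definition connection_set :: "nat \<Rightarrow> nat set \<Rightarrow> nat set" where
  "connection_set n S = S \<union> (\<lambda>s. n - s) ` S"

lemma int_diff_mod_eq_iff:
  assumes "i < n" "j < n" "s < n"
  shows "(int j - int i) mod int n = int s \<longleftrightarrow> j = (i + s) mod n"
proof
  assume "(int j - int i) mod int n = int s"
  hence "(int i + int s) mod int n = (int i + (int j - int i)) mod int n"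
    by (metis mod_add_right_eq)
  hence "int ((i + s) mod n) = int j" using assms by (simp add: zmod_int)
  thus "j = (i + s) mod n" by simp
next
  assume "j = (i + s) mod n"
  hence "(int j - int i) mod int n = ((int i + int s) mod int n - int i) mod int n"
    by (simp add: zmod_int)
  also have "\<dots> = int s" using assms by (simp add: mod_diff_left_eq)
  finally show "(int j - int i) mod int n = int s" .
qed

text \<open>The strict bound excludes the half of \<open>n\<close> as a generator, so
  \<open>s\<close> and \<open>n - s\<close> are distinct residues and each generator gives every
  vertex exactly two neighbours.\<close>

locale half_circulant =
  fixes n :: nat and S :: "nat set"
  assumes n_ge_2: "n \<ge> 2" and S_pos: "s \<in> S \<Longrightarrow> s > 0" and S_half: "s \<in> S \<Longrightarrow> 2 * s < n"
begin

abbreviation "D \<equiv> connection_set n S"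

lemma n_pos: "n > 0"
  using n_ge_2 by simp

lemma S_less: "s \<in> S \<Longrightarrow> s < n"
  using S_half by fastforce

lemma finite_S: "finite S"
  by (rule finite_subset[of _ "{..<n}"]) (auto dest: S_less)

lemma D_bounds: "d \<in> D \<Longrightarrow> 0 < d \<and> d < n"
  using S_pos S_less n_pos unfolding connection_set_def by fastforce

lemma sum_connection_set:
  fixes f :: "nat \<Rightarrow> 'a::comm_monoid_add"
  shows "sum f D = (\<Sum>s\<in>S. f s + f (n - s))"
proof -
  have "S \<inter> (\<lambda>s. n - s) ` S = {}"
  proof (rule equals0I)
    fix x assume "x \<in> S \<inter> (\<lambda>s. n - s) ` S"
    then obtain s where "x \<in> S" "s \<in> S" "x = n - s" by blast
    thus False using S_half[of x] S_half[of s] by linarith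
  qed
  moreover have "inj_on (\<lambda>s. n - s) S" by (intro inj_onI) (use S_less in force)
  ultimately show ?thesis
    unfolding connection_set_def using finite_S
    by (simp add: sum.union_disjoint sum.reindex sum.distrib)
qed

lemma parcs_Circ_iff:
  assumes i: "i < n" and j: "j < n"
  shows "(i, j) \<in> parcs (Circ n S) \<longleftrightarrow> j \<in> (\<lambda>d. (i + d) mod n) ` D"
proof -
  have 1: "(int j - int i) mod int n \<in> int ` S \<longleftrightarrow> j \<in> (\<lambda>d. (i + d) mod n) ` S"
    using int_diff_mod_eq_iff[OF i j] S_less by (auto simp: image_iff)
  have "(int i - int j) mod int n = int s \<longleftrightarrow> j = (i + (n - s)) mod n" if s: "s \<in> S" for s
  proof -
    have "(int i - int j) mod int n = int s \<longleftrightarrow> (int j - int i) mod int n = int (n - s)"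
      using zmod_zminus1_eq_if[of "int i - int j" "int n"]
        zmod_zminus1_eq_if[of "int j - int i" "int n"] S_pos[OF s] S_less[OF s]
      by (auto simp: of_nat_diff split: if_splits)
    also have "\<dots> \<longleftrightarrow> j = (i + (n - s)) mod n"
      using int_diff_mod_eq_iff[OF i j, of "n - s"] S_pos[OF s] n_pos by simp
    finally show ?thesis .
  qed
  hence 2: "(int i - int j) mod int n \<in> int ` S \<longleftrightarrow> j \<in> (\<lambda>d. (i + d) mod n) ` (\<lambda>s. n - s) ` S"
    by (auto simp: image_iff)
  \<comment> \<open>The condition \<open>i \<noteq> j\<close> in \<open>Circ\<close> is automatic
    here, since every shift \<open>d\<close> satisfies \<open>0 < d < n\<close>.\<close>
  have "i \<noteq> j" if "j \<in> (\<lambda>d. (i + d) mod n) ` D"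
  proof
    assume "i = j"
    from that obtain d where "d \<in> D" "j = (i + d) mod n" by blast
    with \<open>i = j\<close> have d: "d \<in> D" "i = (i + d) mod n" by auto
    have "(int i - int i) mod int n = int d"
      using int_diff_mod_eq_iff[OF i i, of d] D_bounds[OF d(1)] d(2) by blast
    thus False using D_bounds[OF d(1)] by simp
  qed
  thus ?thesis using 1 2 i j unfolding connection_set_def Circ_def image_Un by auto
qed

lemma inj_on_shift: "inj_on (\<lambda>d. (i + d) mod n) {..<n}"
proof (rule inj_onI)
  fix a b assume ab: "a \<in> {..<n}" "b \<in> {..<n}" "(i + a) mod n = (i + b) mod n"
  hence "[i + a = i + b] (mod n)" by (simp add: cong_def)
  hence "[a = b] (mod n)" by (simp add: cong_add_lcancel_nat)
  thus "a = b" using ab by (simp add: cong_def)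
qed

lemma inj_on_shift_D: "inj_on (\<lambda>d. (i + d) mod n) D"
  by (rule inj_on_subset[OF inj_on_shift]) (use D_bounds in auto)

lemma sum_shift: "(\<Sum>i<n. f ((i + d) mod n)) = (\<Sum>i<n. f i)"
proof -
  have "(\<lambda>i. (d + i) mod n) ` {..<n} = {..<n}"
    using inj_on_shift n_pos by (intro endo_inj_surj) auto
  thus ?thesis using sum.reindex[OF inj_on_shift[of d], of f] by (simp add: add.commute o_def)
qed

lemma sum_neighbours:
  fixes f :: "nat \<Rightarrow> 'a::semiring_1"
  assumes i: "i < n"
  shows "(\<Sum>j<n. (if (i, j) \<in> parcs (Circ n S) then 1 else 0) * f j) = (\<Sum>d\<in>D. f ((i + d) mod n))"
proof -
  have "(\<Sum>j<n. (if (i, j) \<in> parcs (Circ n S) then 1 else 0) * f j)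
      = (\<Sum>j<n. if j \<in> (\<lambda>d. (i + d) mod n) ` D then f j else 0)"
    using parcs_Circ_iff[OF i] by (intro sum.cong) auto
  also have "\<dots> = sum f ({..<n} \<inter> (\<lambda>d. (i + d) mod n) ` D)"
    by (simp add: sum.inter_restrict)
  also have "{..<n} \<inter> (\<lambda>d. (i + d) mod n) ` D = (\<lambda>d. (i + d) mod n) ` D"
    using n_pos by auto
  finally show ?thesis by (simp add: sum.reindex[OF inj_on_shift_D])
qed

lemma pair_graph_Circ: "pair_graph (Circ n S)"
proof unfold_locales
  show "finite (parcs (Circ n S))"
    by (rule finite_subset[of _ "{0..<n} \<times> {0..<n}"]) (auto simp: Circ_def)
  show "symmetric (with_proj (Circ n S))"
    by (auto simp: symmetric_def Circ_def intro!: symI)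
qed (auto simp: Circ_def)

lemma regular_Circ: "regular_graph (2 * card S) (Circ n S)"
  unfolding regular_graph_def
proof (intro conjI ballI pair_graph_Circ)
  fix i assume "i \<in> pverts (Circ n S)"
  hence i: "i < n" by (simp add: Circ_def)
  have "out_arcs (with_proj (Circ n S)) i = Pair i ` (\<lambda>d. (i + d) mod n) ` D" (is "?L = ?R")
  proof
    show "?L \<subseteq> ?R"
    proof
      fix e assume e: "e \<in> ?L"
      then obtain j where "e = (i, j)" "(i, j) \<in> parcs (Circ n S)" by (cases e) auto
      moreover from this have "j < n" by (simp add: Circ_def)
      ultimately show "e \<in> ?R" using parcs_Circ_iff[OF i] by blast
    qed
    show "?R \<subseteq> ?L" using parcs_Circ_iff[OF i] n_pos by auto
  qed
  moreover have "card (Pair i ` X) = card X" for X :: "nat set"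
    by (rule card_image) (simp add: inj_on_def)
  ultimately have "out_degree (with_proj (Circ n S)) i = card D"
    by (simp add: out_degree_def card_image[OF inj_on_shift_D])
  also have "card D = 2 * card S"
    using sum_connection_set[of "\<lambda>_. 1 :: nat"] by simp
  finally show "out_degree (with_proj (Circ n S)) i = 2 * card S" .
qed

lemma circulant_graph_Circ: "circulant_graph (Circ n S)"
proof -
  interpret pair_graph "Circ n S" by (rule pair_graph_Circ)
  let ?f = "\<lparr>iso_verts = id, iso_arcs = id, iso_head = snd, iso_tail = fst\<rparr>"
  have "pre_digraph.digraph_isomorphism (with_proj (Circ n S)) ?f"
    using wf_digraph_axioms by (simp add: pre_digraph.digraph_isomorphism_def)
  moreover have "with_proj (Circ n S) = app_iso ?f (with_proj (Circ n S))"
    by (simp add: app_iso_def with_proj_def)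
  ultimately have "digraph_iso (with_proj (Circ n S)) (with_proj (Circ n S))"
    unfolding digraph_iso_def by blast
  moreover have "S \<subseteq> {1..n div 2}" using S_pos S_half by fastforce
  ultimately show ?thesis unfolding circulant_graph_def using n_ge_2 by blast
qed

end

section \<open>Null spaces by interpolation and the discrete Fourier transform\<close>

lemma kernel_dim_eq_1:
  fixes A :: "'a::field mat"
  assumes A: "A \<in> carrier_mat nr nc" and v: "v \<noteq> 0\<^sub>v nc"
    and ker: "mat_kernel A = range (\<lambda>c. c \<cdot>\<^sub>v v)"
  shows "kernel_dim A = 1"
proof -
  interpret kernel nr nc A by unfold_locales (rule A)
  \<comment> \<open>The scalar 1 puts \<open>v\<close> itself into the kernel, so that
    \<open>{v}\<close> is a basis of it.\<close>
  have "1 \<cdot>\<^sub>v v \<in> mat_kernel A" unfolding ker by (rule rangeI)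
  hence v_ker: "v \<in> mat_kernel A" by (simp only: one_smult_vec)
  have "x \<in> span {v}" if x: "x \<in> mat_kernel A" for x
  proof -
    obtain c where c: "x = c \<cdot>\<^sub>v v" using x unfolding ker by auto
    have "v \<in> span {v}" using Ker.in_own_span[of "{v}"] v_ker by auto
    thus ?thesis
      unfolding c using submodule.smult_closed[OF Ker.span_is_submodule[of "{v}"], of c v] v_ker
      by simp
  qed
  moreover have "span {v} \<subseteq> mat_kernel A" using Ker.span_is_subset2[of "{v}"] v_ker by simp
  ultimately have "span {v} = mat_kernel A" by blast
  hence "dim = 1" using Ker.dim1I[OF _ v v_ker] by simp
  thus ?thesis by (simp only: kernel_dim)
qed

lemma coeff_sum_monom_lessThan:
  "coeff (\<Sum>i<n. monom (f i) i) k = (if k < n then f k else 0)"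
  by (simp add: coeff_sum)

lemma poly_sum_monom:
  fixes f :: "nat \<Rightarrow> 'a::comm_semiring_1"
  shows
  "poly (\<Sum>i\<in>I. monom (f i) i) z = (\<Sum>i\<in>I. f i * z ^ i)"
  by (simp add: poly_sum poly_monom)

text \<open>Multiplying the interpolating polynomial by \<open>x + 1\<close> makes it vanish at all
  \<open>n\<close>-th roots of unity, so it becomes a multiple of \<open>x\<^sup>n - 1\<close>.\<close>

lemma alternating_if_vanishing_at_roots_of_unity:
  fixes f :: "nat \<Rightarrow> complex"
  assumes n: "n > 0"
    and zero: "\<And>z. z ^ n = 1 \<Longrightarrow> z \<noteq> -1 \<Longrightarrow> (\<Sum>i<n. f i * z ^ i) = 0"
  shows "k < n \<Longrightarrow> f k = (-1) ^ k * f 0"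
proof (induction k)
  case (Suc k)
  define p where "p = (\<Sum>i<n. monom (f i) i)"
  \<comment> \<open>The coefficient of degree \<open>n\<close> in the product of
    \<open>x + 1\<close> and \<open>p\<close> is \<open>f (n - 1)\<close>, so the subtraction leaves
    degree below \<open>n\<close>. Vanishing at \<open>n\<close> distinct roots of unity then forces
    \<open>q = 0\<close>.\<close>
  define q where "q = p + pCons 0 p - smult (f (n - 1)) (monom 1 n - 1)"
  have coeff_q: "coeff q j = (if j < n then f j else 0) + (if j = 0 then 0 else if j \<le> n then f (j - 1) else 0)
       - f (n - 1) * ((if j = n then 1 else 0) - (if j = 0 then 1 else 0))" for j
    unfolding q_def p_def
    by (auto simp: coeff_sum_monom_lessThan coeff_pCons split: nat.split)
  have "q = 0"
  proof (rule ccontr)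
    assume q: "q \<noteq> 0"
    have "degree q < n"
    proof (rule degree_lessI)
      show "q \<noteq> 0 \<or> n > 0" using n by simp
      show "\<forall>j\<ge>n. coeff q j = 0" using n by (auto simp: coeff_q)
    qed
    moreover have "poly q z = 0" if z: "z ^ n = 1" for z
    proof -
      have "poly p z * (1 + z) = 0"
        using zero[OF z] by (cases "z = -1") (auto simp: p_def poly_sum_monom)
      thus ?thesis by (simp add: q_def poly_monom z algebra_simps)
    qed
    hence "card {z :: complex. z ^ n = 1} \<le> card {z. poly q z = 0}"
      by (intro card_mono poly_roots_finite q) auto
    hence "n \<le> degree q"
      using card_poly_roots_bound[OF q] card_roots_unity_eq[OF n] by simp
    ultimately show False by simp
  qed
  hence "coeff q (Suc k) = 0" by simp
  \<comment> \<open>As \<open>0 < Suc k < n\<close>, the subtracted multiple of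
    \<open>x ^ n - 1\<close> does not touch this coefficient.\<close>
  hence "f (Suc k) + f k = 0" using Suc.prems unfolding coeff_q by simp
  hence "f (Suc k) = - f k" by (simp only: eq_neg_iff_add_eq_0)
  thus ?case using Suc.IH Suc.prems by simp
qed simp

context half_circulant
begin

lemma adjacency_matrix_Circ:
  "adjacency_matrix (Circ n S) = mat n n (\<lambda>(i, j). if (i, j) \<in> parcs (Circ n S) then 1 else 0)"
  by (auto simp: adjacency_matrix_def Let_def Circ_def intro!: eq_matI)

lemma adjacency_matrix_mult:
  assumes v: "v \<in> carrier_vec n" and i: "i < n"
  shows "(adjacency_matrix (Circ n S) *\<^sub>v v) $ i = (\<Sum>d\<in>D. v $ ((i + d) mod n))"
  using sum_neighbours[OF i, of "\<lambda>j. v $ j"] v i unfolding adjacency_matrix_Circ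
  by (simp add: scalar_prod_def lessThan_atLeast0)

lemma sum_connection_set_power:
  fixes z :: "'a::field"
  assumes z: "z ^ n = 1"
  shows "(\<Sum>d\<in>D. z ^ d) = (\<Sum>s\<in>S. power_trace z s)"
    and "(\<Sum>d\<in>D. inverse z ^ d) = (\<Sum>s\<in>S. power_trace z s)"
proof -
  have z0: "z \<noteq> 0" using z n_pos by (auto simp: power_0_left)
  have "z ^ (n - s) = inverse z ^ s" if "s \<in> S" for s
    using S_less[OF that] z0 z by (simp add: power_diff power_inverse divide_inverse)
  moreover from this have "inverse z ^ (n - s) = z ^ s" if "s \<in> S" for s
    using that by (simp add: power_inverse)
  ultimately show "(\<Sum>d\<in>D. z ^ d) = (\<Sum>s\<in>S. power_trace z s)"
    and "(\<Sum>d\<in>D. inverse z ^ d) = (\<Sum>s\<in>S. power_trace z s)"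
    unfolding sum_connection_set by (auto simp: power_trace_def add.commute intro!: sum.cong)
qed

text \<open>The discrete Fourier transform diagonalises the circulant matrix: a cyclic shift by
  \<open>d\<close> multiplies the transform at \<open>z\<close> by \<open>inverse z ^ d\<close>, and
  summing over \<open>D\<close> yields the eigenvalue.\<close>

lemma sum_neighbours_power:
  fixes f :: "nat \<Rightarrow> 'a::field"
  assumes z: "z ^ n = 1"
  shows "(\<Sum>i<n. (\<Sum>d\<in>D. f ((i + d) mod n)) * z ^ i)
           = (\<Sum>s\<in>S. power_trace z s) * (\<Sum>i<n. f i * z ^ i)"
proof -
  have z0: "z \<noteq> 0" using z n_pos by (auto simp: power_0_left)
  have "(\<Sum>i<n. (\<Sum>d\<in>D. f ((i + d) mod n)) * z ^ i)
      = (\<Sum>d\<in>D. \<Sum>i<n. f ((i + d) mod n) * z ^ i)"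
    unfolding sum_distrib_right by (rule sum.swap)
  also have "\<dots> = (\<Sum>d\<in>D. inverse z ^ d * (\<Sum>i<n. f ((i + d) mod n) * z ^ ((i + d) mod n)))"
    unfolding power_mod_root_of_unity[OF z] sum_distrib_left
    using z0 by (intro sum.cong) (simp_all add: power_add power_inverse)
  also have "\<dots> = (\<Sum>d\<in>D. inverse z ^ d * (\<Sum>i<n. f i * z ^ i))"
    unfolding sum_shift[where f = "\<lambda>i. f i * z ^ i"] ..
  finally show ?thesis
    by (simp add: sum_distrib_right[symmetric] sum_connection_set_power(2)[OF z])
qed

text \<open>The transform of a kernel vector vanishes at each \<open>n\<close>-th root of unity
  other than -1, because the eigenvalue there is nonzero; hence the vector is alternating.
  Conversely, the alternating vector lies in the kernel because the eigenvalue at -1 is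
  zero.\<close>

lemma nut_graph_Circ:
  assumes even: "even n"
    and zero_iff: "\<And>z :: complex. z ^ n = 1 \<Longrightarrow> (\<Sum>s\<in>S. power_trace z s) = 0 \<longleftrightarrow> z = -1"
  shows "nut_graph (Circ n S)"
proof -
  let ?A = "adjacency_matrix (Circ n S)"
  define u :: "real vec" where "u = vec n (\<lambda>i. (-1) ^ i)"
  have A: "?A \<in> carrier_mat n n" by (simp add: adjacency_matrix_Circ)
  have u: "u \<in> carrier_vec n" by (simp add: u_def)
  have u_nz: "\<forall>i<n. u $ i \<noteq> 0" by (simp add: u_def)
  hence "u $ 0 \<noteq> 0\<^sub>v n $ 0" using n_pos by simp
  hence u0: "u \<noteq> 0\<^sub>v n" by metis
  have ker: "mat_kernel ?A = range (\<lambda>c. c \<cdot>\<^sub>v u)"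
  proof (intro equalityI subsetI)
    fix v assume "v \<in> mat_kernel ?A"
    hence v: "v \<in> carrier_vec n" "?A *\<^sub>v v = 0\<^sub>v n" using mat_kernelD[OF A] by auto
    have "(\<Sum>i<n. complex_of_real (v $ i) * z ^ i) = 0" if z: "z ^ n = 1" "z \<noteq> -1" for z
    proof -
      have "(\<Sum>d\<in>D. complex_of_real (v $ ((i + d) mod n))) = 0" if "i < n" for i
        using adjacency_matrix_mult[OF v(1) that] v(2) that by (simp flip: of_real_sum)
      hence "(\<Sum>i<n. (\<Sum>d\<in>D. complex_of_real (v $ ((i + d) mod n))) * z ^ i) = 0" by simp
      thus ?thesis
        using sum_neighbours_power[OF z(1), of "\<lambda>i. complex_of_real (v $ i)"] zero_iff[OF z(1)] z(2)
        by simp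
    qed
    hence "complex_of_real (v $ k) = (-1) ^ k * complex_of_real (v $ 0)" if "k < n" for k
      by (rule alternating_if_vanishing_at_roots_of_unity[OF n_pos _ that])
    moreover have "(-1) ^ k * complex_of_real (v $ 0) = complex_of_real ((-1) ^ k * v $ 0)" for k
      by simp
    ultimately have v_alt: "v $ k = (-1) ^ k * v $ 0" if "k < n" for k
      using that by (metis of_real_eq_iff)
    have "v = v $ 0 \<cdot>\<^sub>v u"
    proof (rule eq_vecI)
      fix k assume "k < dim_vec (v $ 0 \<cdot>\<^sub>v u)"
      hence k: "k < n" using u by simp
      show "v $ k = (v $ 0 \<cdot>\<^sub>v u) $ k" using k by (subst v_alt[OF k]) (simp add: u_def)
    qed (use u v(1) in simp)
    thus "v \<in> range (\<lambda>c. c \<cdot>\<^sub>v u)" by blast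
  next
    fix v assume "v \<in> range (\<lambda>c. c \<cdot>\<^sub>v u)"
    then obtain c where c: "v = c \<cdot>\<^sub>v u" by blast
    \<comment> \<open>Evenness of \<open>n\<close> makes -1 an \<open>n\<close>-th root of unity, so
      alternating signs survive the reduction of indices modulo \<open>n\<close>.\<close>
    have m1: "(-1 :: real) ^ n = 1" using even by simp
    have "(-1 :: complex) ^ n = 1" using even by simp
    hence "(\<Sum>s\<in>S. power_trace (-1 :: complex) s) = 0" using zero_iff by blast
    \<comment> \<open>The eigenvalue is known to vanish over the complex numbers, while the
      adjacency matrix is real; at -1 both readings agree.\<close>
    moreover have "power_trace (-1 :: complex) s = of_real (power_trace (-1) s)" for s
      by (simp add: power_trace_def)
    ultimately have "complex_of_real (\<Sum>s\<in>S. power_trace (-1) s) = 0" by simp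
    hence "(\<Sum>s\<in>S. power_trace (-1 :: real) s) = 0" by (simp only: of_real_eq_0_iff)
    hence D0: "(\<Sum>d\<in>D. (-1 :: real) ^ d) = 0" using sum_connection_set_power(1)[OF m1] by simp
    have "?A *\<^sub>v v = 0\<^sub>v n"
    proof (rule eq_vecI)
      fix i assume "i < dim_vec (0\<^sub>v n :: real vec)"
      hence i: "i < n" by simp
      have "(?A *\<^sub>v v) $ i = (\<Sum>d\<in>D. c * (-1) ^ ((i + d) mod n))"
        using adjacency_matrix_mult[OF _ i, of v] u n_pos by (simp add: c u_def)
      also have "\<dots> = c * (-1) ^ i * (\<Sum>d\<in>D. (-1) ^ d)"
        unfolding power_mod_root_of_unity[OF m1] by (simp add: power_add sum_distrib_left mult.assoc)
      finally show "(?A *\<^sub>v v) $ i = 0\<^sub>v n $ i" using i D0 by simp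
    qed (use A in simp)
    thus "v \<in> mat_kernel ?A" using u by (intro mat_kernelI[OF A]) (auto simp: c)
  qed
  have "card (pverts (Circ n S)) = n" by (simp add: Circ_def)
  thus ?thesis
    unfolding nut_graph_def using n_ge_2 u0 u_nz
    by (intro conjI exI[of _ u] pair_graph_Circ kernel_dim_eq_1[OF A u0 ker] ker) simp_all
qed

end

theorem theorem4p1:
  fixes t n :: nat
  assumes "t \<ge> 4" and "even t"
    and "n \<ge> 4 * t + 16" and "8 dvd n"
  shows "regular_graph (4 * t) (Circ n (S' t n))
       \<and> circulant_nut_graph (Circ n (S' t n))
       \<and> card (pverts (Circ n (S' t n))) = n"
proof -
  obtain m where n: "n = 8 * m" using assms by blast
  have m: "t + 4 \<le> 2 * m" using assms n by simp
  have "0 < s \<and> 2 * s < n" if "s \<in> S' t n" for s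
    using that m assms(1) unfolding S'_eq_reflected[OF assms(1) n m]
    by (auto simp: initial_gens_def n)
  moreover have "n \<ge> 2" using n m by simp
  ultimately interpret half_circulant n "S' t n"
    by unfold_locales auto
  have "card (initial_gens t) = t - 1"
  proof -
    have "initial_gens t = {1..t} - {t - 2}" using assms by (auto simp: initial_gens_def)
    thus ?thesis using assms by simp
  qed
  \<comment> \<open>Two blocks of size \<open>t - 1\<close> and the two middle generators give
    \<open>2 * t\<close>. The count is made in the integers because \<open>sum_S'\<close> is stated
    for groups.\<close>
  hence "int (card (S' t n)) = int (2 * t)"
    using sum_S'[OF assms(1) n m, of "\<lambda>_. 1 :: int"] assms by (simp add: of_nat_diff)
  hence "2 * card (S' t n) = 4 * t" by simp
  hence "regular_graph (4 * t) (Circ n (S' t n))" using regular_Circ by simp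
  moreover have "nut_graph (Circ n (S' t n))"
    using sum_power_trace_S'_eq_0_iff[OF assms(2,1) n m] assms(4) by (intro nut_graph_Circ) auto
  ultimately show ?thesis
    unfolding circulant_nut_graph_def using circulant_graph_Circ by (simp add: Circ_def)
qed

end
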